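(* Let $(N,m_0)$ be an ordinary Petri net with uncontrollable transition set $T_u$, let $(\omega_1,k_1)$ and $(\omega_2,k_2)$ be linear constraints, let $Q=Q_{(\omega_1,k_1)}\cup Q_{(\omega_2,k_2)}$, and let $t\in T_u$. Then $$Q_t=(Q_{(\omega_1,k_1)})_t\cup(Q_{(\omega_2,k_2)})_t\cup C_{1\to2}\cup C_{2\to1}.$$
   Context: $\mathbb N=\{0,1,2,\dots\}$. An ordinary Petri net is $N=(P,T,F)$ with $P$ (places), $T$ (transitions) finite, nonempty, disjoint, and $F\subseteq(P\times T)\cup(T\times P)$; $T=T_u\cup T_c$ is partitioned into uncontrollable and controllable transitions. For a node $x$, ${}^\bullet x=\{y:(y,x)\in F\}$ and $x^\bullet=\{y:(x,y)\in F\}$. The incidence matrix $[N]$ has entries $[N](p,t)=-1$ if $p\in{}^\bullet t\setminus t^\bullet$, $1$ if $p\in t^\bullet\setminus{}^\bullet t$, and $0$ otherwise. A marking is a map $m:P\to\mathbb N$; $\mathcal M=\mathbb N^{|P|}$ is the set of all markings. A transition $t$ is enabled at $m$ if $m(p)>0$ for all $p\in{}^\bullet t$; then it can fire, written $m[t\rangle m'$, with $m'(p)=m(p)+[N](p,t)$. $R_t(N,m)$ is the set of markings (including $m$) reachable from $m$ by firing only $t$. For $Q\subseteq\mathcal M$, $\bar Q=\mathcal M\setminus Q$. For $Q\subseteq\mathcal M$ and $t\in T_u$, the escaping-marking set is $\Gamma(Q,t)=\{m\in Q:\exists m'\in R_t(N,m),\ m'\in\bar Q\}$, and the transforming marking set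 is $Q_t=Q\setminus\Gamma(Q,t)$. A linear constraint is a pair $(\omega,k)$ with $\omega:P\to\mathbb N$ a weight vector and $k$ an integer; it requires $\omega\cdot m\le k$. $Q_{(\omega,k)}=\{m\in\mathcal M:\omega\cdot m\le k\}$. The complementary-marking set (relative to $t$) from $(\omega_i,k_i)$ to $(\omega_j,k_j)$ is $C_{i\to j}=\{m\in\Gamma(Q_{(\omega_i,k_i)},t)\cap\bar Q_{(\omega_j,k_j)}:\ \exists m'\in R_t(N,m)\cap Q_{(\omega_i,k_i)}\text{ such that } m'[t\rangle m''\text{ and }m''\in\bar Q_{(\omega_i,k_i)}\cap Q_{(\omega_j,k_j)}\}$. *)

theory Defs
  imports Main "HOL-Library.FuncSet"
begin

text \<open>
  Places and transitions are subsets of one type of nodes, so that presets and postsets are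
  defined for arbitrary nodes.
\<close>

record 'a petri_net =
  places :: "'a set"
  transitions :: "'a set"
  flow :: "('a \<times> 'a) set"
  uncontrollable :: "'a set"
  controllable :: "'a set"

definition ordinary_petri_net :: "'a petri_net \<Rightarrow> bool" where
  "ordinary_petri_net N \<longleftrightarrow>
     finite (places N) \<and> places N \<noteq> {} \<and>
     finite (transitions N) \<and> transitions N \<noteq> {} \<and>
     places N \<inter> transitions N = {} \<and>
     flow N \<subseteq> (places N \<times> transitions N) \<union> (transitions N \<times> places N) \<and>
     uncontrollable N \<union> controllable N = transitions N \<and>
     uncontrollable N \<inter> controllable N = {}"

definition preset :: "'a petri_net \<Rightarrow> 'a \<Rightarrow> 'a set" where
  "preset N x = {y. (y, x) \<in> flow N}"

definition postset :: "'a petri_net \<Rightarrow> 'a \<Rightarrow> 'a set" where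
  "postset N x = {y. (x, y) \<in> flow N}"

definition incidence :: "'a petri_net \<Rightarrow> 'a \<Rightarrow> 'a \<Rightarrow> int" where
  "incidence N p t =
     (if p \<in> preset N t - postset N t then - 1
      else if p \<in> postset N t - preset N t then 1
      else 0)"

text \<open>
  A marking is a function on the places; extensionality (the value \<open>undefined\<close> at all other
  nodes) makes equality of markings mean equality on the places.
\<close>

definition markings :: "'a petri_net \<Rightarrow> ('a \<Rightarrow> nat) set" where
  "markings N = places N \<rightarrow>\<^sub>E UNIV"

definition enabled :: "'a petri_net \<Rightarrow> ('a \<Rightarrow> nat) \<Rightarrow> 'a \<Rightarrow> bool" where
  "enabled N m t \<longleftrightarrow> (\<forall>p\<in>preset N t. m p > 0)"

definition fires :: "'a petri_net \<Rightarrow> 'a \<Rightarrow> ('a \<Rightarrow> nat) \<Rightarrow> ('a \<Rightarrow> nat) \<Rightarrow> bool" where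
  "fires N t m m' \<longleftrightarrow>
     m \<in> markings N \<and> m' \<in> markings N \<and> enabled N m t \<and>
     (\<forall>p\<in>places N. int (m' p) = int (m p) + incidence N p t)"

definition reach_by :: "'a petri_net \<Rightarrow> 'a \<Rightarrow> ('a \<Rightarrow> nat) \<Rightarrow> ('a \<Rightarrow> nat) set" where
  "reach_by N t m = {m'. (fires N t)\<^sup>*\<^sup>* m m'}"

definition compl_markings :: "'a petri_net \<Rightarrow> ('a \<Rightarrow> nat) set \<Rightarrow> ('a \<Rightarrow> nat) set" where
  "compl_markings N Q = markings N - Q"

definition escaping :: "'a petri_net \<Rightarrow> ('a \<Rightarrow> nat) set \<Rightarrow> 'a \<Rightarrow> ('a \<Rightarrow> nat) set" where
  "escaping N Q t = {m \<in> Q. \<exists>m'\<in>reach_by N t m. m' \<in> compl_markings N Q}"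

definition transforming :: "'a petri_net \<Rightarrow> ('a \<Rightarrow> nat) set \<Rightarrow> 'a \<Rightarrow> ('a \<Rightarrow> nat) set" where
  "transforming N Q t = Q - escaping N Q t"

text \<open>
  Only the values of a weight vector at the places of the net matter, so weight vectors are left
  unrestricted elsewhere.
\<close>

type_synonym 'a linear_constraint = "('a \<Rightarrow> nat) \<times> int"

definition satisfying :: "'a petri_net \<Rightarrow> 'a linear_constraint \<Rightarrow> ('a \<Rightarrow> nat) set" where
  "satisfying N c = {m \<in> markings N. int (\<Sum>p\<in>places N. fst c p * m p) \<le> snd c}"

definition complementary ::
  "'a petri_net \<Rightarrow> 'a \<Rightarrow> 'a linear_constraint \<Rightarrow> 'a linear_constraint \<Rightarrow> ('a \<Rightarrow> nat) set" where
  "complementary N t c d =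
     {m \<in> escaping N (satisfying N c) t \<inter> compl_markings N (satisfying N d).
        \<exists>m' \<in> reach_by N t m \<inter> satisfying N c. \<exists>m''. fires N t m' m'' \<and>
          m'' \<in> compl_markings N (satisfying N c) \<inter> satisfying N d}"

end

theory Submission
  imports Defs
begin

text \<open>
  Every firing of \<open>t\<close> changes the weight \<open>\<omega> \<cdot> m\<close> by the same amount, so along a firing sequence of \<open>t\<close>
  each constraint either remains satisfied, remains violated, or changes its status exactly once. If a
  marking satisfying both constraints escapes both, the two weights increase, and the later of the
  two violations violates both. In a complementary marking the first constraint
  is satisfied up to the switch \<open>m'[t\<rangle>m''\<close> and the second one from there on.
\<close>

definition weight :: "'a petri_net \<Rightarrow> 'a linear_constraint \<Rightarrow> ('a \<Rightarrow> nat) \<Rightarrow> int" where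
  "weight N c m = int (\<Sum>p\<in>places N. fst c p * m p)"

text \<open>The scalar product of the weights with the column of \<open>t\<close> in the incidence
  matrix. It does not depend on the marking, so the weight is affine in the number of
  firings.\<close>

definition weight_change :: "'a petri_net \<Rightarrow> 'a \<Rightarrow> 'a linear_constraint \<Rightarrow> int" where
  "weight_change N t c = (\<Sum>p\<in>places N. int (fst c p) * incidence N p t)"

lemma satisfying_iff: "m \<in> satisfying N c \<longleftrightarrow> m \<in> markings N \<and> weight N c m \<le> snd c"
  by (simp add: satisfying_def weight_def)

lemma weight_fires:
  assumes "fires N t m m'"
  shows "weight N c m' = weight N c m + weight_change N t c"
  using assms
  by (simp add: weight_def weight_change_def fires_def distrib_left flip: sum.distrib)

lemma weight_relpowp:
  "(fires N t ^^ n) m m' \<Longrightarrow> weight N c m' = weight N c m + int n * weight_change N t c"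
proof (induction n arbitrary: m')
  case (Suc n)
  then obtain x where "(fires N t ^^ n) m x" "fires N t x m'"
    by auto
  then show ?case
    using Suc.IH weight_fires[of N t x m' c] by (simp add: algebra_simps)
qed simp

lemma reach_by_iff: "m' \<in> reach_by N t m \<longleftrightarrow> (\<exists>n. (fires N t ^^ n) m m')"
  by (auto simp: reach_by_def rtranclp_power)

lemma reach_by_markings:
  assumes "m \<in> markings N" "m' \<in> reach_by N t m"
  shows "m' \<in> markings N"
proof -
  have "(fires N t)\<^sup>*\<^sup>* m m'"
    using assms(2) by (simp add: reach_by_def)
  then show ?thesis
    by (cases rule: rtranclp.cases) (use assms(1) in \<open>auto simp: fires_def\<close>)
qed

text \<open>Escaping refers to the complement within \<open>markings N\<close>. Firing never leaves
  \<open>markings N\<close>, so not escaping is plain containment of the reachable set;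
  \<open>m \<in> Q\<close> supplies that \<open>m\<close> is a marking.\<close>

lemma transforming_iff:
  assumes "Q \<subseteq> markings N"
  shows "m \<in> transforming N Q t \<longleftrightarrow> m \<in> Q \<and> reach_by N t m \<subseteq> Q"
  using assms reach_by_markings[of m N _ t]
  by (auto simp: transforming_def escaping_def compl_markings_def)

lemma satisfying_subset_markings: "satisfying N c \<subseteq> markings N"
  by (auto simp: satisfying_iff)

text \<open>Induction on the firing sequence: either its last firing leaves \<open>A\<close>, or the
  marking before that firing is already outside \<open>A\<close>. It provides the switch required by
  \<open>complementary\<close>.\<close>

lemma first_exit:
  assumes "(fires N t)\<^sup>*\<^sup>* m x" "m \<in> A" "x \<notin> A"
  obtains m' m'' where "m' \<in> reach_by N t m" "m' \<in> A" "fires N t m' m''" "m'' \<notin> A"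
proof -
  have "\<exists>m' m''. (fires N t)\<^sup>*\<^sup>* m m' \<and> m' \<in> A \<and> fires N t m' m'' \<and> m'' \<notin> A"
    using assms by (induction rule: rtranclp_induct) blast+
  then show ?thesis
    using that by (auto simp: reach_by_def)
qed

lemma simultaneous_violation:
  assumes x: "x \<in> reach_by N t m" and y: "y \<in> reach_by N t m"
    and c: "weight N c m \<le> snd c" "snd c < weight N c x"
    and d: "weight N d m \<le> snd d" "snd d < weight N d y"
  shows "\<exists>z\<in>reach_by N t m. snd c < weight N c z \<and> snd d < weight N d z"
proof -
  obtain i j where i: "(fires N t ^^ i) m x" and j: "(fires N t ^^ j) m y"
    using x y by (auto simp: reach_by_iff)
  \<comment> \<open>Both weights are strictly larger at the violation than at \<open>m\<close>,
    which forces a positive number of firings and a positive change.\<close>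
  have "0 < int i * weight_change N t c" "0 < int j * weight_change N t d"
    using c d weight_relpowp[OF i, of c] weight_relpowp[OF j, of d] by linarith+
  then have pos: "0 < weight_change N t c" "0 < weight_change N t d"
    by (auto simp: zero_less_mult_iff)
  show ?thesis
  proof (cases "i \<le> j")
    case True
    then have "int i * weight_change N t c \<le> int j * weight_change N t c"
      using pos by (intro mult_right_mono) auto
    then have "snd c < weight N c y"
      using c weight_relpowp[OF i, of c] weight_relpowp[OF j, of c] by linarith
    then show ?thesis
      using y d by blast
  next
    case False
    then have "int j * weight_change N t d \<le> int i * weight_change N t d"
      using pos by (intro mult_right_mono) auto
    then have "snd d < weight N d x"
      using d weight_relpowp[OF i, of d] weight_relpowp[OF j, of d] by linarith
    then show ?thesis
      using x c by blast
  qed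
qed

lemma complementary_transforming:
  assumes "m \<in> complementary N t c d"
  shows "m \<in> transforming N (satisfying N c \<union> satisfying N d) t"
proof -
  from assms obtain m' m'' where m: "m \<in> satisfying N c" "m \<notin> satisfying N d"
    and m': "m' \<in> reach_by N t m" "m' \<in> satisfying N c" and fire: "fires N t m' m''"
    and m'': "m'' \<in> markings N" "m'' \<notin> satisfying N c" "m'' \<in> satisfying N d"
    by (auto simp: complementary_def escaping_def compl_markings_def)
  have mark: "m \<in> markings N"
    using m(1) by (simp add: satisfying_iff)
  obtain n where n: "(fires N t ^^ n) m m'"
    using m'(1) by (auto simp: reach_by_iff)
  then have n': "(fires N t ^^ Suc n) m m''"
    using fire by auto
  \<comment> \<open>A single firing, the switch, turns \<open>c\<close> from satisfied to
    violated.\<close>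
  have "0 < weight_change N t c"
    using m' m'' weight_fires[OF fire, of c] by (auto simp: satisfying_iff)
  \<comment> \<open>\<open>d\<close> is violated at \<open>m\<close> but satisfied at
    \<open>m''\<close>, which is \<open>Suc n\<close> firings later.\<close>
  moreover have "int (Suc n) * weight_change N t d < 0"
    using m mark m'' weight_relpowp[OF n', of d] unfolding satisfying_iff by linarith
  then have "weight_change N t d < 0"
    by (auto simp: mult_less_0_iff)
  moreover have "x \<in> satisfying N c \<union> satisfying N d" if x: "x \<in> reach_by N t m" for x
  proof -
    obtain l where l: "(fires N t ^^ l) m x"
      using x by (auto simp: reach_by_iff)
    have x_mark: "x \<in> markings N"
      using reach_by_markings[OF mark x] .
    show ?thesis
    \<comment> \<open>Up to \<open>m'\<close> the increasing weight of \<open>c\<close> is at most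
      its value there; from \<open>m''\<close> on the decreasing weight of \<open>d\<close> is at
      most its value there. No marking lies between the two.\<close>
    proof (cases "l \<le> n")
      case True
      then have "int l * weight_change N t c \<le> int n * weight_change N t c"
        using \<open>0 < weight_change N t c\<close> by (intro mult_right_mono) auto
      then have "weight N c x \<le> snd c"
        using m' weight_relpowp[OF l, of c] weight_relpowp[OF n, of c]
        unfolding satisfying_iff by linarith
      then show ?thesis
        using x_mark by (simp add: satisfying_iff)
    next
      case False
      then have "int l * weight_change N t d \<le> int (Suc n) * weight_change N t d"
        using \<open>weight_change N t d < 0\<close> by (intro mult_right_mono_neg) auto
      then have "weight N d x \<le> snd d"
        using m'' weight_relpowp[OF l, of d] weight_relpowp[OF n', of d]
        unfolding satisfying_iff by linarith
      then show ?thesis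
        using x_mark by (simp add: satisfying_iff)
    qed
  qed
  ultimately show ?thesis
    using m(1) satisfying_subset_markings[of N c] satisfying_subset_markings[of N d]
    by (subst transforming_iff) auto
qed

text \<open>Starting inside \<open>satisfying N c\<close> leaves only one direction of switching, so
  only one complementary set occurs. The other direction follows by exchanging \<open>c\<close> and
  \<open>d\<close>.\<close>

lemma transforming_cases:
  assumes m: "m \<in> transforming N (satisfying N c \<union> satisfying N d) t"
    and mc: "m \<in> satisfying N c"
  shows "m \<in> transforming N (satisfying N c) t \<union> transforming N (satisfying N d) t \<union>
    complementary N t c d"
proof (cases "reach_by N t m \<subseteq> satisfying N c")
  case True
  then show ?thesis
    using mc by (simp add: transforming_iff[OF satisfying_subset_markings])
next
  case False
  then obtain x where x: "x \<in> reach_by N t m" "x \<notin> satisfying N c"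
    by blast
  have mark: "m \<in> markings N"
    using mc by (simp add: satisfying_iff)
  note reach_mark = reach_by_markings[OF mark]
  have reach: "reach_by N t m \<subseteq> satisfying N c \<union> satisfying N d"
    using m by (simp add: transforming_iff satisfying_subset_markings)
  show ?thesis
  proof (cases "m \<in> satisfying N d")
    case True
    \<comment> \<open>Since \<open>x\<close> already violates \<open>c\<close>, a violation of
      \<open>d\<close> would give a reachable marking outside both sets.\<close>
    have "y \<in> satisfying N d" if y: "y \<in> reach_by N t m" for y
    proof (rule ccontr)
      assume "y \<notin> satisfying N d"
      then have "\<exists>z\<in>reach_by N t m. snd c < weight N c z \<and> snd d < weight N d z"
        using mc True x reach_mark[OF x(1)] reach_mark[OF y]
        by (intro simultaneous_violation[OF x(1) y]) (auto simp: satisfying_iff)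
      then show False
        using reach by (force simp: satisfying_iff)
    qed
    then show ?thesis
      using True by (auto simp: transforming_iff[OF satisfying_subset_markings])
  next
    case False
    obtain m' m'' where m': "m' \<in> reach_by N t m" "m' \<in> satisfying N c"
      and fire: "fires N t m' m''" and m'': "m'' \<notin> satisfying N c"
      using first_exit[of N t m x "satisfying N c"] x mc by (auto simp: reach_by_def)
    have m''_reach: "m'' \<in> reach_by N t m"
      using m'(1) fire by (auto simp: reach_by_def)
    \<comment> \<open>The whole reachable set lies in the union, so a marking that has left the
      first set is in the second.\<close>
    then have "m'' \<in> satisfying N d"
      using reach m'' by blast
    moreover have "m \<in> escaping N (satisfying N c) t"
      using mc x reach_mark[OF x(1)] by (auto simp: escaping_def compl_markings_def)
    moreover have "m \<in> compl_markings N (satisfying N d)"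
      using mark False by (simp add: compl_markings_def)
    moreover have "m'' \<in> compl_markings N (satisfying N c)"
      using m'' reach_mark[OF m''_reach] by (simp add: compl_markings_def)
    ultimately have "m \<in> complementary N t c d"
      using m' fire unfolding complementary_def by blast
    then show ?thesis
      by blast
  qed
qed

theorem theorem11:
  fixes N :: "'a petri_net" and m\<^sub>0 :: "'a \<Rightarrow> nat"
    and \<omega>\<^sub>1 \<omega>\<^sub>2 :: "'a \<Rightarrow> nat" and k\<^sub>1 k\<^sub>2 :: int
    and Q :: "('a \<Rightarrow> nat) set" and t :: 'a
  assumes "ordinary_petri_net N"
    and "m\<^sub>0 \<in> markings N"
    and "Q = satisfying N (\<omega>\<^sub>1, k\<^sub>1) \<union> satisfying N (\<omega>\<^sub>2, k\<^sub>2)"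
    and "t \<in> uncontrollable N"
  shows "transforming N Q t =
           transforming N (satisfying N (\<omega>\<^sub>1, k\<^sub>1)) t \<union>
           transforming N (satisfying N (\<omega>\<^sub>2, k\<^sub>2)) t \<union>
           complementary N t (\<omega>\<^sub>1, k\<^sub>1) (\<omega>\<^sub>2, k\<^sub>2) \<union>
           complementary N t (\<omega>\<^sub>2, k\<^sub>2) (\<omega>\<^sub>1, k\<^sub>1)"
proof -
  let ?c = "(\<omega>\<^sub>1, k\<^sub>1)" and ?d = "(\<omega>\<^sub>2, k\<^sub>2)"
  \<comment> \<open>The swapped union lets both lemmas be applied with the constraints
    exchanged.\<close>
  have Q': "Q = satisfying N ?d \<union> satisfying N ?c"
    using assms(3) by (simp add: Un_commute)
  have "m \<in> transforming N Q t \<longleftrightarrow> m \<in> transforming N (satisfying N ?c) t \<or>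
      m \<in> transforming N (satisfying N ?d) t \<or> m \<in> complementary N t ?c ?d \<or>
      m \<in> complementary N t ?d ?c" (is "?L \<longleftrightarrow> ?R") for m
  proof
    assume L: ?L
    then consider "m \<in> satisfying N ?c" | "m \<in> satisfying N ?d"
      unfolding assms(3) transforming_def by blast
    then show ?R
    proof cases
      case 1
      with L show ?thesis
        using transforming_cases[of m N ?c ?d t] assms(3) by simp blast
    next
      case 2
      with L show ?thesis
        using transforming_cases[of m N ?d ?c t] Q' by simp blast
    qed
  next
    assume ?R
    then consider "m \<in> transforming N (satisfying N ?c) t"
      | "m \<in> transforming N (satisfying N ?d) t"
      | "m \<in> complementary N t ?c ?d" | "m \<in> complementary N t ?d ?c"
      by blast
    then show ?L
    proof cases
      case 3
      then show ?thesis
        unfolding assms(3) by (rule complementary_transforming)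
    next
      case 4
      then show ?thesis
        unfolding Q' by (rule complementary_transforming)
    \<comment> \<open>In the two remaining cases the reachable set lies in one of the sets, hence in
      the union.\<close>
    qed (auto simp: assms(3) transforming_iff satisfying_subset_markings)
  qed
  then show ?thesis
    by blast
qed

end
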